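(* Let $R$ be a right Rickart ring and let $H$ be the monoid of left zero divisors of $R$. An element $a \in R$ is an $\mathrm{r.Fix}_R$-quark of $H$ if and only if $a$ is a coprimitive idempotent of $R$.
   Context: Rings are associative, non-zero, with identity $1_R$, not necessarily commutative. For $a \in R$, $\mathrm{r.ann}(a) := \{x \in R : ax = 0\}$ and $\mathrm{r.Fix}(a) := \mathrm{r.ann}(1_R - a) = \{x \in R : ax = x\}$; both are right ideals. $R$ is right Rickart if $\mathrm{r.ann}(a)$ is a direct summand of the right module $R_R$ for every $a \in R$. The monoid of left zero divisors of $R$ is the multiplicative submonoid $H := \{a \in R : \mathrm{r.ann}(a) \neq \{0\}\} \cup \{1_R\}$. The $\mathrm{r.Fix}_R$-preorder on $H$ is defined by $b \preceq c$ iff $\mathrm{r.Fix}(c) \subseteq \mathrm{r.Fix}(b)$; write $b \prec c$ if $b \preceq c$ and $c \not\preceq b$. An $\mathrm{r.Fix}_R$-unit of $H$ is an element $u \in H$ with $u \preceq 1_R \preceq u$ (the only one is $1_R$); the other elements of $H$ are $\mathrm{r.Fix}_R$-non-units. An $\mathrm{r.Fix}_R$-quark of $H$ is an $\mathrm{r.Fix}_R$-non-unit $a \in H$ such that there is no $\mathrm{r.Fix}_R$-non-unit $b \in H$ with $b \prec a$. An idempotent $e \in R$ is coprimitive if $\mathrm{r.ann}(e)$ is an indecomposable submodule of $R_R$, where a module is indecomposable if it is non-zero and is not the direct sum of two non-zero submodules. *)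

theory Defs
  imports Main
begin

text \<open>
  A ring is a type of class \<^class>\<open>ring_1\<close>: associative, unital, not necessarily commutative, with
  \<open>0 \<noteq> 1\<close>. The submodules of the right regular module are the right ideals.
\<close>

definition rann :: "'a::ring_1 \<Rightarrow> 'a set" where
  "rann a = {x. a * x = 0}"

definition rFix :: "'a::ring_1 \<Rightarrow> 'a set" where
  "rFix a = rann (1 - a)"

text \<open>Closure under negation follows from multiplication by \<open>-1\<close> on the right.\<close>

definition right_ideal :: "'a::ring_1 set \<Rightarrow> bool" where
  "right_ideal I \<longleftrightarrow>
     0 \<in> I \<and> (\<forall>x\<in>I. \<forall>y\<in>I. x + y \<in> I) \<and> (\<forall>x\<in>I. \<forall>r. x * r \<in> I)"

definition is_direct_sum :: "'a::ring_1 set \<Rightarrow> 'a set \<Rightarrow> 'a set \<Rightarrow> bool" where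
  "is_direct_sum M A B \<longleftrightarrow>
     right_ideal A \<and> right_ideal B \<and> M = {x + y | x y. x \<in> A \<and> y \<in> B} \<and> A \<inter> B = {0}"

definition direct_summand :: "'a::ring_1 set \<Rightarrow> bool" where
  "direct_summand A \<longleftrightarrow> (\<exists>B. is_direct_sum UNIV A B)"

definition right_Rickart :: "'a::ring_1 itself \<Rightarrow> bool" where
  "right_Rickart (_ :: 'a itself) \<longleftrightarrow> (\<forall>a::'a. direct_summand (rann a))"

definition indecomposable :: "'a::ring_1 set \<Rightarrow> bool" where
  "indecomposable M \<longleftrightarrow>
     right_ideal M \<and> M \<noteq> {0} \<and> \<not> (\<exists>A B. A \<noteq> {0} \<and> B \<noteq> {0} \<and> is_direct_sum M A B)"

definition coprimitive_idempotent :: "'a::ring_1 \<Rightarrow> bool" where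
  "coprimitive_idempotent e \<longleftrightarrow> e * e = e \<and> indecomposable (rann e)"

definition left_zero_divisor_monoid :: "'a::ring_1 set" where
  "left_zero_divisor_monoid = {a. rann a \<noteq> {0}} \<union> {1}"

definition rFix_le :: "'a::ring_1 \<Rightarrow> 'a \<Rightarrow> bool" where
  "rFix_le b c \<longleftrightarrow> rFix c \<subseteq> rFix b"

definition rFix_less :: "'a::ring_1 \<Rightarrow> 'a \<Rightarrow> bool" where
  "rFix_less b c \<longleftrightarrow> rFix_le b c \<and> \<not> rFix_le c b"

definition rFix_unit :: "'a::ring_1 set \<Rightarrow> 'a \<Rightarrow> bool" where
  "rFix_unit H u \<longleftrightarrow> u \<in> H \<and> rFix_le u 1 \<and> rFix_le 1 u"

definition rFix_non_unit :: "'a::ring_1 set \<Rightarrow> 'a \<Rightarrow> bool" where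
  "rFix_non_unit H a \<longleftrightarrow> a \<in> H \<and> \<not> rFix_unit H a"

definition rFix_quark :: "'a::ring_1 set \<Rightarrow> 'a \<Rightarrow> bool" where
  "rFix_quark H a \<longleftrightarrow> rFix_non_unit H a \<and> \<not> (\<exists>b. rFix_non_unit H b \<and> rFix_less b a)"

lemma rFix_eq: "rFix a = {x. a * x = x}"
  by (auto simp: rFix_def rann_def algebra_simps)

lemma right_ideal_rann: "right_ideal (rann a)"
  by (simp add: right_ideal_def rann_def distrib_left flip: mult.assoc)

lemma right_ideal_rFix: "right_ideal (rFix a)"
  by (simp add: rFix_def right_ideal_rann)

lemma one_mem_left_zero_divisor_monoid: "1 \<in> left_zero_divisor_monoid"
  by (simp add: left_zero_divisor_monoid_def)

lemma mult_mem_left_zero_divisor_monoid: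
  assumes "a \<in> left_zero_divisor_monoid" "b \<in> left_zero_divisor_monoid"
  shows "a * b \<in> left_zero_divisor_monoid"
proof (cases "b = 1")
  case False
  then have "rann b \<noteq> {0}"
    using assms by (auto simp: left_zero_divisor_monoid_def)
  moreover have "0 \<in> rann b" "rann b \<subseteq> rann (a * b)"
    by (auto simp: rann_def mult.assoc)
  ultimately have "rann (a * b) \<noteq> {0}"
    by blast
  then show ?thesis
    by (simp add: left_zero_divisor_monoid_def)
qed (use assms in simp)

lemma rFix_unit_iff:
  fixes u :: "'a::ring_1"
  shows "rFix_unit left_zero_divisor_monoid u \<longleftrightarrow> u = 1"
proof
  assume "rFix_unit left_zero_divisor_monoid u"
  then have "rFix 1 \<subseteq> rFix u"
    by (simp add: rFix_unit_def rFix_le_def)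
  moreover have "1 \<in> rFix (1::'a)"
    by (simp add: rFix_eq)
  ultimately have "1 \<in> rFix u"
    by blast
  then show "u = 1"
    by (simp add: rFix_eq)
qed (simp add: rFix_unit_def rFix_le_def one_mem_left_zero_divisor_monoid)

end

theory Submission
  imports Defs
begin

text \<open>
  Quarks are the elements \<open>a\<close> with \<open>rann a \<noteq> {0}\<close> whose \<open>rFix a\<close> is maximal. Always
  \<open>rann (a - a\<^sup>2) = rFix a \<oplus> rann a\<close>; in a Rickart ring this has a complement \<open>C\<close>, and the idempotent
  projecting onto \<open>rFix a \<oplus> C\<close> along \<open>rann a\<close> shows, by maximality, that \<open>C = 0\<close>, that is, \<open>a\<^sup>2 = a\<close>.
  A splitting \<open>rann a = A \<oplus> B\<close> would likewise give the larger fixed set \<open>rFix a \<oplus> A\<close>. Conversely,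
  if \<open>a\<close> is idempotent, \<open>rFix a \<subset> rFix b\<close> and \<open>K\<close> is a complement of \<open>rFix b\<close>, then
  \<open>rann a = (rann a \<inter> rFix b) \<oplus> (1 - a) K\<close>.
\<close>

section \<open>Closure properties of right ideals\<close>

lemma right_ideal_diff:
  assumes "right_ideal I" "x \<in> I" "y \<in> I"
  shows "x - y \<in> I"
proof -
  have "y * (- 1) \<in> I"
    using assms unfolding right_ideal_def by blast
  then have "x + y * (- 1) \<in> I"
    using assms unfolding right_ideal_def by blast
  then show ?thesis
    by simp
qed

lemma right_ideal_zero: "right_ideal I \<Longrightarrow> 0 \<in> I"
  and right_ideal_add: "right_ideal I \<Longrightarrow> x \<in> I \<Longrightarrow> y \<in> I \<Longrightarrow> x + y \<in> I"
  and right_ideal_mult: "right_ideal I \<Longrightarrow> x \<in> I \<Longrightarrow> x * r \<in> I"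
  by (auto simp: right_ideal_def)

lemma right_ideal_sum:
  assumes "right_ideal A" "right_ideal B"
  shows "right_ideal {x + y | x y. x \<in> A \<and> y \<in> B}" (is "right_ideal ?S")
  unfolding right_ideal_def
proof (intro conjI ballI allI)
  show "0 \<in> ?S"
    using assms[THEN right_ideal_zero] by force
next
  fix u v assume "u \<in> ?S" "v \<in> ?S"
  then obtain x y x' y' where "u = x + y" "v = x' + y'" "x \<in> A" "y \<in> B" "x' \<in> A" "y' \<in> B"
    by blast
  moreover from this have "u + v = (x + x') + (y + y')" "x + x' \<in> A" "y + y' \<in> B"
    using assms by (auto intro: right_ideal_add simp: algebra_simps)
  ultimately show "u + v \<in> ?S"
    by blast
next
  fix u r assume "u \<in> ?S"
  then obtain x y where "u = x + y" "x \<in> A" "y \<in> B"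
    by blast
  moreover from this have "u * r = x * r + y * r" "x * r \<in> A" "y * r \<in> B"
    using assms by (auto intro: right_ideal_mult simp: algebra_simps)
  ultimately show "u * r \<in> ?S"
    by blast
qed

lemma right_ideal_Int: "right_ideal A \<Longrightarrow> right_ideal B \<Longrightarrow> right_ideal (A \<inter> B)"
  by (simp add: right_ideal_def)

lemma right_ideal_left_mult_image:
  assumes "right_ideal K"
  shows "right_ideal ((*) c ` K)"
  unfolding right_ideal_def
proof (intro conjI ballI allI)
  show "0 \<in> (*) c ` K"
    using right_ideal_zero[OF assms] by force
next
  fix x y assume "x \<in> (*) c ` K" "y \<in> (*) c ` K"
  then obtain k l where "k \<in> K" "l \<in> K" "x = c * k" "y = c * l"
    by blast
  then have "x + y = c * (k + l)" "k + l \<in> K"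
    using assms by (auto intro: right_ideal_add simp: algebra_simps)
  then show "x + y \<in> (*) c ` K"
    by blast
next
  fix x r assume "x \<in> (*) c ` K"
  then obtain k where "k \<in> K" "x = c * k"
    by blast
  then have "x * r = c * (k * r)" "k * r \<in> K"
    using assms by (auto intro: right_ideal_mult simp: mult.assoc)
  then show "x * r \<in> (*) c ` K"
    by blast
qed

section \<open>Direct sum decompositions and projections\<close>

text \<open>Write \<open>1 = e + f\<close> with \<open>e\<close> in \<open>A\<close> and
  \<open>f\<close> in \<open>B\<close>; since both are right ideals, left multiplication by
  \<open>e\<close> projects onto \<open>A\<close> along \<open>B\<close>. This turns decompositions
  into elements that can be compared with a quark.\<close>

lemma is_direct_sum_UNIV_projection:
  fixes A B :: "'a::ring_1 set"
  assumes "is_direct_sum UNIV A B"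
  obtains e where "rFix e = A" "rann e = B"
proof -
  have A: "right_ideal A" and B: "right_ideal B" and AB: "A \<inter> B = {0}"
    and U: "UNIV = {x + y | x y. x \<in> A \<and> y \<in> B}"
    using assms unfolding is_direct_sum_def by blast+
  have "(1::'a) \<in> {x + y | x y. x \<in> A \<and> y \<in> B}"
    using U by blast
  then obtain e f where ef: "1 = e + f" "e \<in> A" "f \<in> B"
    by blast
  have dec: "e * x + f * x = x" for x
    by (metis ef(1) distrib_right mult_1)
  have eA: "e * x \<in> A" and fB: "f * x \<in> B" for x
    using A B ef right_ideal_mult by blast+
  have "e * x = x" if "x \<in> A" for x
  proof -
    \<comment> \<open>For \<open>x\<close> in \<open>A\<close>, this places \<open>f * x\<close> in
      both summands, so it vanishes.\<close>
    have "f * x = x - e * x"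
      using dec[of x] by (simp add: eq_diff_eq add.commute)
    then have "f * x \<in> A \<inter> B"
      using right_ideal_diff[OF A that eA] fB by (metis IntI)
    then show ?thesis
      using AB dec[of x] by simp
  qed
  moreover have "e * x = 0" if "x \<in> B" for x
  proof -
    have "e * x = x - f * x"
      using dec[of x] by (simp add: eq_diff_eq)
    then have "e * x \<in> A \<inter> B"
      using right_ideal_diff[OF B that fB] eA by (metis IntI)
    then show ?thesis
      using AB by simp
  qed
  moreover have "x \<in> A" if "e * x = x" for x
    using eA[of x] that by simp
  moreover have "x \<in> B" if "e * x = 0" for x
    using fB[of x] dec[of x] that by simp
  ultimately have "rFix e = A" "rann e = B"
    unfolding rFix_eq rann_def by blast+
  then show ?thesis
    by (rule that)
qed

text \<open>Regroups \<open>(A + B) + C\<close> as \<open>(A + C) + B\<close>: the summand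
  \<open>B\<close> is kept, to serve later as an annihilator, while its complement grows.\<close>

lemma is_direct_sum_assoc:
  assumes M: "is_direct_sum M A B" and N: "is_direct_sum N M C"
  obtains D where "is_direct_sum N D B" "A \<subseteq> D" "C \<subseteq> D"
proof
  let ?D = "{x + y | x y. x \<in> A \<and> y \<in> C}"
  have A: "right_ideal A" and B: "right_ideal B" and C: "right_ideal C"
    and AB: "A \<inter> B = {0}" and MC: "M \<inter> C = {0}"
    and M_eq: "M = {x + y | x y. x \<in> A \<and> y \<in> B}"
    and N_eq: "N = {x + y | x y. x \<in> M \<and> y \<in> C}" and M': "right_ideal M"
    using M N unfolding is_direct_sum_def by blast+
  have "A \<subseteq> M" "B \<subseteq> M"
    using A[THEN right_ideal_zero] B[THEN right_ideal_zero] unfolding M_eq by force+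
  show "A \<subseteq> ?D" "C \<subseteq> ?D"
    using A[THEN right_ideal_zero] C[THEN right_ideal_zero] by force+
  have "z = 0" if z: "z \<in> ?D" "z \<in> B" for z
  proof -
    obtain x y where xy: "z = x + y" "x \<in> A" "y \<in> C"
      using z by blast
    have "z - x \<in> M"
      using xy z \<open>A \<subseteq> M\<close> \<open>B \<subseteq> M\<close> M' by (intro right_ideal_diff) auto
    then have "y \<in> M \<inter> C"
      using xy by simp
    then have "z \<in> A \<inter> B"
      using MC xy z by simp
    then show ?thesis
      using AB by blast
  qed
  then have "?D \<inter> B = {0}"
    using right_ideal_zero[OF B] right_ideal_zero[OF right_ideal_sum[OF A C]] by blast
  moreover have "N = {x + y | x y. x \<in> ?D \<and> y \<in> B}"
  proof (intro equalityI subsetI)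
    fix z assume "z \<in> N"
    then obtain x y w where "z = (x + y) + w" "x \<in> A" "y \<in> B" "w \<in> C"
      unfolding N_eq M_eq by blast
    moreover from this have "z = (x + w) + y"
      by (simp add: algebra_simps)
    ultimately show "z \<in> {x + y | x y. x \<in> ?D \<and> y \<in> B}"
      by blast
  next
    fix z assume "z \<in> {x + y | x y. x \<in> ?D \<and> y \<in> B}"
    then obtain x y w where "z = (x + w) + y" "x \<in> A" "y \<in> B" "w \<in> C"
      by blast
    moreover from this have "z = (x + y) + w"
      by (simp add: algebra_simps)
    ultimately show "z \<in> N"
      unfolding N_eq M_eq by blast
  qed
  ultimately show "is_direct_sum N ?D B"
    using B right_ideal_sum[OF A C] by (simp add: is_direct_sum_def)
qed

section \<open>Fixed sets and annihilators\<close>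

lemma rFix_Int_rann: "rFix a \<inter> rann a = {0}"
  by (auto simp: rFix_eq rann_def)

text \<open>The commuting factors \<open>a\<close> and \<open>1 - a\<close> of
  \<open>a - a * a\<close> have sum 1, so each \<open>x\<close> splits as
  \<open>a * x + (x - a * x)\<close>.\<close>

lemma is_direct_sum_rFix_rann:
  "is_direct_sum (rann (a - a * a)) (rFix a) (rann a)"
  unfolding is_direct_sum_def
proof (intro conjI right_ideal_rFix right_ideal_rann rFix_Int_rann equalityI subsetI)
  fix x assume "x \<in> rann (a - a * a)"
  then have "a * x \<in> rFix a" "x - a * x \<in> rann a"
    by (auto simp: rann_def rFix_eq algebra_simps)
  moreover have "x = a * x + (x - a * x)"
    by simp
  ultimately show "x \<in> {x + y | x y. x \<in> rFix a \<and> y \<in> rann a}"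
    by blast
next
  fix z assume "z \<in> {x + y | x y. x \<in> rFix a \<and> y \<in> rann a}"
  then obtain x y where "z = x + y" "a * x = x" "a * y = 0"
    by (auto simp: rFix_eq rann_def)
  then show "z \<in> rann (a - a * a)"
    by (simp add: rann_def algebra_simps)
qed

section \<open>Quarks are coprimitive idempotents\<close>

lemma rann_one: "rann 1 = {0}"
  by (auto simp: rann_def)

lemma rFix_non_unit_iff:
  "rFix_non_unit left_zero_divisor_monoid a \<longleftrightarrow> rann a \<noteq> {0}"
  unfolding rFix_non_unit_def rFix_unit_iff by (auto simp: left_zero_divisor_monoid_def rann_one)

lemma rFix_quark_iff:
  "rFix_quark left_zero_divisor_monoid a \<longleftrightarrow>
     rann a \<noteq> {0} \<and> (\<forall>b. rann b \<noteq> {0} \<longrightarrow> rFix a \<subseteq> rFix b \<longrightarrow> rFix b \<subseteq> rFix a)"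
  unfolding rFix_quark_def rFix_non_unit_iff rFix_less_def rFix_le_def by blast

text \<open>The projection onto \<open>D\<close> along \<open>B\<close> has annihilator
  \<open>B\<close>, which is nonzero, so maximality of \<open>rFix a\<close> applies to it.\<close>

lemma rFix_quark_is_direct_sum:
  assumes "rFix_quark left_zero_divisor_monoid a" "is_direct_sum UNIV D B" "B \<noteq> {0}" "rFix a \<subseteq> D"
  shows "D \<subseteq> rFix a"
proof -
  obtain b where "rFix b = D" "rann b = B"
    using is_direct_sum_UNIV_projection[OF assms(2)] .
  then show ?thesis
    using assms unfolding rFix_quark_iff by blast
qed

lemma rFix_quark_idempotent:
  fixes a :: "'a::ring_1"
  assumes "right_Rickart TYPE('a)" and quark: "rFix_quark left_zero_divisor_monoid a"
  shows "a * a = a"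
proof -
  obtain C where C: "is_direct_sum UNIV (rann (a - a * a)) C"
    using assms(1) unfolding right_Rickart_def direct_summand_def by blast
  obtain D where D: "is_direct_sum UNIV D (rann a)" "rFix a \<subseteq> D" "C \<subseteq> D"
    using is_direct_sum_assoc[OF is_direct_sum_rFix_rann C] .
  have "rann a \<noteq> {0}"
    using quark by (simp add: rFix_quark_iff)
  then have "C \<subseteq> rFix a"
    using rFix_quark_is_direct_sum[OF quark D(1) _ D(2)] D(3) by simp
  also have "\<dots> \<subseteq> rann (a - a * a)"
    by (auto simp: rFix_eq rann_def algebra_simps)
  finally have "C \<subseteq> {0}"
    using C unfolding is_direct_sum_def by blast
  \<comment> \<open>As \<open>C\<close> is zero, the decomposition of 1 puts 1 itself into the
    annihilator of \<open>a - a * a\<close>.\<close>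
  moreover have "(1::'a) \<in> {x + y | x y. x \<in> rann (a - a * a) \<and> y \<in> C}"
    using C unfolding is_direct_sum_def by blast
  ultimately have "1 \<in> rann (a - a * a)"
    by force
  then show ?thesis
    by (simp add: rann_def)
qed

lemma is_direct_sum_commute: "is_direct_sum M A B \<Longrightarrow> is_direct_sum M B A"
  unfolding is_direct_sum_def by (auto simp: Int_commute) (metis add.commute)+

lemma rFix_quark_indecomposable:
  assumes idem: "a * a = a" and quark: "rFix_quark left_zero_divisor_monoid a"
  shows "indecomposable (rann a)"
  unfolding indecomposable_def
proof (intro conjI notI)
  show "right_ideal (rann a)"
    by (rule right_ideal_rann)
  show False if "rann a = {0}"
    using quark that by (simp add: rFix_quark_iff)
  assume "\<exists>A B. A \<noteq> {0} \<and> B \<noteq> {0} \<and> is_direct_sum (rann a) A B"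
  then obtain A B where AB: "A \<noteq> {0}" "B \<noteq> {0}" "is_direct_sum (rann a) A B"
    by blast
  \<comment> \<open>Idempotence gives \<open>a - a * a = 0\<close>, whose annihilator is the whole
    ring.\<close>
  have "is_direct_sum UNIV (rann a) (rFix a)"
    using is_direct_sum_commute[OF is_direct_sum_rFix_rann[of a]] idem by (simp add: rann_def)
  then obtain D where D: "is_direct_sum UNIV D B" "A \<subseteq> D" "rFix a \<subseteq> D"
    using is_direct_sum_assoc[OF AB(3)] by blast
  then have "A \<subseteq> rFix a"
    using rFix_quark_is_direct_sum[OF quark D(1) AB(2)] by blast
  moreover have "0 \<in> A" "0 \<in> B"
    using AB(3) by (auto simp: is_direct_sum_def right_ideal_def)
  moreover from this have "A \<subseteq> rann a"
    using AB(3) unfolding is_direct_sum_def by force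
  ultimately show False
    using AB(1) rFix_Int_rann[of a] by blast
qed

section \<open>Coprimitive idempotents are quarks\<close>

text \<open>Apply \<open>1 - a\<close>, the projection onto \<open>rann a\<close> along
  \<open>rFix a\<close>, to \<open>F + K\<close>. It maps \<open>F\<close> into itself because
  \<open>F\<close> contains \<open>rFix a\<close>.\<close>

lemma is_direct_sum_rann_of_complement:
  assumes idem: "a * a = a" and le: "rFix a \<subseteq> F" and FK: "is_direct_sum UNIV F K"
  shows "is_direct_sum (rann a) (rann a \<inter> F) ((*) (1 - a) ` K)"
proof -
  have F: "right_ideal F" and K: "right_ideal K" and Int: "F \<inter> K = {0}"
    and U: "UNIV = {x + y | x y. x \<in> F \<and> y \<in> K}"
    using FK unfolding is_direct_sum_def by blast+
  have aF: "a * x \<in> F" for x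
  proof -
    have "a * x \<in> rFix a"
      by (simp add: rFix_eq idem flip: mult.assoc)
    then show ?thesis
      using le by blast
  qed
  have ann: "(1 - a) * x \<in> rann a" for x
    by (simp add: rann_def idem right_diff_distrib flip: mult.assoc)
  have "rann a = {x + y | x y. x \<in> rann a \<inter> F \<and> y \<in> (*) (1 - a) ` K}"
  proof (intro equalityI subsetI)
    fix z assume z: "z \<in> rann a"
    have "z \<in> {x + y | x y. x \<in> F \<and> y \<in> K}"
      using U by blast
    then obtain x y where xy: "z = x + y" "x \<in> F" "y \<in> K"
      by blast
    have "(1 - a) * x \<in> F"
      using right_ideal_diff[OF F xy(2) aF] by (simp add: algebra_simps)
    moreover have "z = (1 - a) * z"
      using z by (simp add: rann_def algebra_simps)
    then have "z = (1 - a) * x + (1 - a) * y"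
      by (simp add: xy(1) distrib_left)
    ultimately show "z \<in> {x + y | x y. x \<in> rann a \<inter> F \<and> y \<in> (*) (1 - a) ` K}"
      using ann xy(3) by blast
  next
    fix z assume "z \<in> {x + y | x y. x \<in> rann a \<inter> F \<and> y \<in> (*) (1 - a) ` K}"
    then show "z \<in> rann a"
      using ann right_ideal_add[OF right_ideal_rann] by blast
  qed
  moreover have "z = 0" if z: "z \<in> F" "z \<in> (*) (1 - a) ` K" for z
  proof -
    obtain k where k: "k \<in> K" "z = k - a * k"
      using z(2) by (auto simp: algebra_simps)
    \<comment> \<open>Adding back \<open>a * k\<close> recovers \<open>k\<close>, which then lies in
      both \<open>F\<close> and \<open>K\<close>.\<close>
    have "z + a * k \<in> F"
      using right_ideal_add[OF F z(1) aF] .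
    then have "k \<in> F \<inter> K"
      using k by simp
    then show ?thesis
      using Int k by simp
  qed
  then have "(rann a \<inter> F) \<inter> (*) (1 - a) ` K = {0}"
    using F K right_ideal_rann[of a] right_ideal_left_mult_image[of K "1 - a"]
    by (auto dest!: right_ideal_zero)
  ultimately show ?thesis
    using F K by (simp add: is_direct_sum_def right_ideal_Int right_ideal_rann
        right_ideal_left_mult_image)
qed

lemma coprimitive_idempotent_rFix_quark:
  fixes a :: "'a::ring_1"
  assumes Rickart: "right_Rickart TYPE('a)" and cop: "coprimitive_idempotent a"
  shows "rFix_quark left_zero_divisor_monoid a"
  unfolding rFix_quark_iff
proof (intro conjI allI impI)
  have idem: "a * a = a" and ind: "indecomposable (rann a)"
    using cop by (auto simp: coprimitive_idempotent_def)
  then show "rann a \<noteq> {0}"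
    by (simp add: indecomposable_def)
  fix b assume b: "rann b \<noteq> {0}" and le: "rFix a \<subseteq> rFix b"
  \<comment> \<open>The Rickart condition is used for \<open>1 - b\<close>.\<close>
  obtain K where K: "is_direct_sum UNIV (rFix b) K"
    using Rickart unfolding right_Rickart_def direct_summand_def rFix_def by blast
  have Int: "rFix b \<inter> K = {0}"
    using K by (simp add: is_direct_sum_def)
  have K0: "K \<noteq> {0}"
  proof
    assume "K = {0}"
    moreover have "(1::'a) \<in> {x + y | x y. x \<in> rFix b \<and> y \<in> K}"
      using K unfolding is_direct_sum_def by blast
    ultimately have "1 \<in> rFix b"
      by auto
    then show False
      using b by (simp add: rFix_eq rann_one)
  qed
  \<comment> \<open>If \<open>1 - a\<close> killed \<open>K\<close>, then \<open>K\<close> would lie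
    in \<open>rFix a\<close>, hence in \<open>rFix b\<close>, which it meets only in 0.\<close>
  have "(*) (1 - a) ` K \<noteq> {0}"
  proof
    assume "(*) (1 - a) ` K = {0}"
    then have "K \<subseteq> rFix a"
      by (auto simp: rFix_def rann_def)
    then show False
      using le Int K0 by blast
  qed
  then have "rann a \<inter> rFix b = {0}"
    using ind is_direct_sum_rann_of_complement[OF idem le K] unfolding indecomposable_def by metis
  \<comment> \<open>Membership in this zero intersection forces \<open>a * x = x\<close>.\<close>
  moreover have "x - a * x \<in> rann a \<inter> rFix b" if "x \<in> rFix b" for x
  proof -
    have ax: "a * x \<in> rFix a"
      by (simp add: rFix_eq idem flip: mult.assoc)
    have "x - a * x \<in> rFix b"
      using right_ideal_diff[OF right_ideal_rFix that] ax le by blast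
    then show ?thesis
      using ax by (simp add: rann_def rFix_eq right_diff_distrib)
  qed
  ultimately have "x - a * x = 0" if "x \<in> rFix b" for x
    using that by blast
  then show "rFix b \<subseteq> rFix a"
    unfolding rFix_eq[of a] by (metis (mono_tags) eq_iff_diff_eq_0 mem_Collect_eq subsetI)
qed

theorem theorem5p2:
  fixes a :: "'a::ring_1"
  assumes "right_Rickart TYPE('a)"
  shows "rFix_quark left_zero_divisor_monoid a \<longleftrightarrow> coprimitive_idempotent a"
  using assms rFix_quark_idempotent rFix_quark_indecomposable coprimitive_idempotent_rFix_quark
  unfolding coprimitive_idempotent_def by blast

end
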